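(* Let $A$ be a finite abelian group and let $n\in\mathbb{N}$. Then $A\wr F_n \in \mathcal{G}'_\infty$ and $A\wr\mathbb{Z}^n\in\mathcal{G}'_\infty$, where $F_n$ is the free group on $n$ generators and $\wr$ denotes the restricted wreath product.
   Context: For a finite alphabet $\Sigma$ with $|\Sigma|\ge 2$, $\mathrm{Aut}(\Sigma^{\mathbb{N}})$ is the group of homeomorphisms of $\Sigma^{\mathbb{N}}$ (product topology) commuting with the one-sided shift $\sigma(x)_i = x_{i+1}$. $\mathcal{G}'_n$ is the class of groups isomorphic to a subgroup of $\mathrm{Aut}(\Sigma^{\mathbb{N}})$ where $|\Sigma| = n$, and $\mathcal{G}'_\infty = \bigcup_n \mathcal{G}'_n$. $A\wr G = \left(\bigoplus_{G} A\right)\rtimes G$. *)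

theory Defs
  imports "HOL-Analysis.Function_Topology" "HOL-Algebra.Bij" "HOL-Algebra.Product_Groups"
begin

definition full_shift :: "'s set \<Rightarrow> (nat \<Rightarrow> 's) topology"
  where "full_shift S = product_topology (\<lambda>_. discrete_topology S) UNIV"

definition shift_map :: "(nat \<Rightarrow> 's) \<Rightarrow> nat \<Rightarrow> 's"
  where "shift_map x = (\<lambda>i. x (Suc i))"

(* Elements of BijGroup are restricted to their domain (undefined elsewhere), so equality of
   automorphisms is equality of maps on the shift space. *)
definition shift_aut_group :: "'s set \<Rightarrow> ((nat \<Rightarrow> 's) \<Rightarrow> (nat \<Rightarrow> 's)) monoid"
  where "shift_aut_group S =
    BijGroup (topspace (full_shift S))
      \<lparr>carrier := {f \<in> Bij (topspace (full_shift S)).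
          homeomorphic_map (full_shift S) (full_shift S) f \<and>
          (\<forall>x \<in> topspace (full_shift S). f (shift_map x) = shift_map (f x))}\<rparr>"

(* Up to isomorphism, the group depends only on the cardinality of the alphabet, so finite sets
   of natural numbers suffice as alphabets. *)
definition shift_aut_class :: "nat \<Rightarrow> 'g monoid set"
  where "shift_aut_class n =
    {G. group G \<and>
        (\<exists>(S :: nat set) H. finite S \<and> card S = n \<and> subgroup H (shift_aut_group S) \<and>
            G \<cong> shift_aut_group S \<lparr>carrier := H\<rparr>)}"

definition shift_aut_class_inf :: "'g monoid set"
  where "shift_aut_class_inf = (\<Union>n\<in>{2..}. shift_aut_class n)"

definition semidirect_product ::
    "('a, 'c) monoid_scheme \<Rightarrow> ('b, 'd) monoid_scheme \<Rightarrow> ('b \<Rightarrow> 'a \<Rightarrow> 'a) \<Rightarrow> ('a \<times> 'b) monoid"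
  where "semidirect_product N H \<phi> =
    \<lparr>carrier = carrier N \<times> carrier H,
     monoid.mult = (\<lambda>(a, g) (b, h). (a \<otimes>\<^bsub>N\<^esub> \<phi> g b, g \<otimes>\<^bsub>H\<^esub> h)),
     one = (\<one>\<^bsub>N\<^esub>, \<one>\<^bsub>H\<^esub>)\<rparr>"

(* G acts on the direct sum of copies of A by left translation of the coordinates. *)
definition wreath_product ::
    "('a, 'c) monoid_scheme \<Rightarrow> ('b, 'd) monoid_scheme \<Rightarrow> (('b \<Rightarrow> 'a) \<times> 'b) monoid"
  where "wreath_product A G =
    semidirect_product (sum_group (carrier G) (\<lambda>_. A)) G
      (\<lambda>g f. \<lambda>x\<in>carrier G. f (inv\<^bsub>G\<^esub> g \<otimes>\<^bsub>G\<^esub> x))"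

(* A letter (x, True) stands for the generator x, and (x, False) for its inverse. *)
definition inv_letter :: "'x \<times> bool \<Rightarrow> 'x \<times> bool"
  where "inv_letter a = (fst a, \<not> snd a)"

definition reduced_word :: "('x \<times> bool) list \<Rightarrow> bool"
  where "reduced_word w \<longleftrightarrow> (\<forall>i. Suc i < length w \<longrightarrow> w ! Suc i \<noteq> inv_letter (w ! i))"

fun cons_reduce :: "'x \<times> bool \<Rightarrow> ('x \<times> bool) list \<Rightarrow> ('x \<times> bool) list"
  where
    "cons_reduce a [] = [a]"
  | "cons_reduce a (b # w) = (if b = inv_letter a then w else a # b # w)"

(* For a reduced word w, foldr cons_reduce v w is the reduced form of the concatenation v @ w. *)
definition free_group :: "'x set \<Rightarrow> ('x \<times> bool) list monoid"
  where "free_group gens =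
    \<lparr>carrier = {w \<in> lists (gens \<times> UNIV). reduced_word w},
     monoid.mult = (\<lambda>v w. foldr cons_reduce v w),
     one = []\<rparr>"

definition int_power_group :: "nat \<Rightarrow> (nat \<Rightarrow> int) monoid"
  where "int_power_group n = product_group {..<n} (\<lambda>_. integer_group)"

end

theory Submission
  imports Defs "HOL-Algebra.Free_Abelian_Groups"
begin

text \<open>Suppose \<open>G\<close> acts on \<open>S\<^sup>\<nat>\<close> by shift-commuting homeomorphisms and some set \<open>C\<close> of letters
  separates: every finite nonempty \<open>F \<subseteq> G\<close> has a point \<open>x\<close> such that exactly one \<open>g \<in> F\<close> brings
  \<open>x\<close> into the cylinder \<open>{x. x 0 \<in> C}\<close>. Over the alphabet \<open>S \<times> A\<close> a finitely supported
  \<open>f : G \<rightarrow> A\<close> acts by multiplying the second coordinate at \<open>i\<close> with the product of those \<open>f k\<close> for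
  which the \<open>i\<close>-th shift of \<open>inv k\<close> applied to the first coordinate lies in the cylinder. Together with
  \<open>G\<close> these maps form a copy of the wreath product, and separation makes the action faithful.

  A separating action of the free group comes from a free product of groups of order two. Each
  generator \<open>a\<close> adds to the bit of a column labelled \<open>a\<close> the bit of the next column. If the labels
  spell a word \<open>u\<close> without repeated neighbours, followed by bits \<open>1\<close>, then the first bit after
  applying \<open>w\<close> counts modulo 2 the occurrences of \<open>u\<close> as a subsequence of \<open>w\<close>, as in the Magnus
  expansion. So among words not longer than \<open>u\<close> it detects exactly \<open>u\<close>. Using several tracks in
  parallel gives the same for subgroups of finite products of free groups, such as \<open>\<int>\<^sup>n\<close>.\<close>

section \<open>Shift-commuting homeomorphisms\<close>

lemma topspace_full_shift: "x \<in> topspace (full_shift S) \<longleftrightarrow> (\<forall>i. x i \<in> S)"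
  by (simp add: full_shift_def PiE_UNIV_domain Pi_iff)

lemma shift_map_closed:
  "x \<in> topspace (full_shift S) \<Longrightarrow> shift_map x \<in> topspace (full_shift S)"
  by (simp add: topspace_full_shift shift_map_def)

text \<open>Around each point the cylinder fixing coordinates up to \<open>m\<close> is a basic open
  set on which coordinate \<open>i\<close> of the image is constant, so preimages of sets of letters
  are open.\<close>

lemma continuous_map_full_shift:
  assumes closed: "\<And>x. x \<in> topspace (full_shift S) \<Longrightarrow> f x \<in> topspace (full_shift T)"
    and local: "\<And>i. \<exists>m. \<forall>x \<in> topspace (full_shift S). \<forall>y \<in> topspace (full_shift S).
      (\<forall>k\<le>m. x k = y k) \<longrightarrow> f x i = f y i"
  shows "continuous_map (full_shift S) (full_shift T) f"
proof -
  have "continuous_map (full_shift S) (discrete_topology T) (\<lambda>x. f x i)" for i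
  proof -
    obtain m where m: "\<And>x y. \<lbrakk>x \<in> topspace (full_shift S); y \<in> topspace (full_shift S);
        \<forall>k\<le>m. x k = y k\<rbrakk> \<Longrightarrow> f x i = f y i"
      using local [of i] by blast
    have "openin (full_shift S) {x \<in> topspace (full_shift S). f x i \<in> U}" for U
    proof (subst openin_subopen, intro ballI)
      fix x assume x: "x \<in> {x \<in> topspace (full_shift S). f x i \<in> U}"
      define Z where "Z = (\<Pi>\<^sub>E k\<in>UNIV. if k \<le> m then {x k} else S)"
      have "openin (full_shift S) Z"
        unfolding Z_def full_shift_def
      proof (rule product_topology_basis)
        show "openin (discrete_topology S) (if k \<le> m then {x k} else S)" for k
          using x by (simp add: topspace_full_shift)
        have "{k. (if k \<le> m then {x k} else S) \<noteq> S} \<subseteq> {..m}"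
          by (auto split: if_splits)
        then show "finite {k. (if k \<le> m then {x k} else S) \<noteq> topspace (discrete_topology S)}"
          by (simp add: finite_subset)
      qed
      moreover have "x \<in> Z"
        using x by (simp add: Z_def topspace_full_shift PiE_UNIV_domain Pi_iff)
      moreover have "Z \<subseteq> {x \<in> topspace (full_shift S). f x i \<in> U}"
      proof
        fix y assume "y \<in> Z"
        then have yZ: "y k \<in> (if k \<le> m then {x k} else S)" for k
          by (simp add: Z_def PiE_UNIV_domain Pi_iff)
        then have eq: "\<forall>k\<le>m. x k = y k"
          by (metis singletonD)
        have "y \<in> topspace (full_shift S)"
          unfolding topspace_full_shift
        proof
          show "y k \<in> S" for k
            using yZ [of k] x by (cases "k \<le> m") (simp_all add: topspace_full_shift)
        qed
        then show "y \<in> {x \<in> topspace (full_shift S). f x i \<in> U}"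
          using m [OF _ _ eq] x by simp
      qed
      ultimately show "\<exists>Z. openin (full_shift S) Z \<and> x \<in> Z \<and>
          Z \<subseteq> {x \<in> topspace (full_shift S). f x i \<in> U}"
        by blast
    qed
    then show ?thesis
      using closed by (simp add: continuous_map_def topspace_full_shift Pi_iff)
  qed
  then show ?thesis
    unfolding full_shift_def [of T] continuous_map_componentwise_UNIV by blast
qed

lemma group_shift_aut_group: "group (shift_aut_group S)"
proof -
  let ?X = "topspace (full_shift S)"
  interpret B: group "BijGroup ?X"
    by (rule group_BijGroup)
  define K where "K = {f \<in> Bij ?X. homeomorphic_map (full_shift S) (full_shift S) f \<and>
      (\<forall>x \<in> ?X. f (shift_map x) = shift_map (f x))}"
  have inv_eq: "inv\<^bsub>BijGroup ?X\<^esub> f = (\<lambda>x\<in>?X. inv_into ?X f x)" if "f \<in> Bij ?X" for f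
    using that Bij_compose_restrict_eq [OF that] restrict_inv_into_Bij [OF that]
    by (intro B.inv_equality) (auto simp: BijGroup_def)
  have "subgroup K (BijGroup ?X)"
  proof (rule B.subgroupI)
    show "K \<subseteq> carrier (BijGroup ?X)"
      by (auto simp: K_def BijGroup_def)
    have "(\<lambda>x\<in>?X. x) \<in> K"
      by (auto simp: K_def id_Bij shift_map_closed intro: homeomorphic_map_eq [OF homeomorphic_map_id [THEN iffD2, OF refl]])
    then show "K \<noteq> {}"
      by blast
    show "inv\<^bsub>BijGroup ?X\<^esub> f \<in> K" if f: "f \<in> K" for f
    proof -
      have fB: "f \<in> Bij ?X" and bij: "bij_betw f ?X ?X"
        using f by (auto simp: K_def Bij_def)
      obtain g where g: "homeomorphic_maps (full_shift S) (full_shift S) f g"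
        using f by (auto simp: K_def homeomorphic_map_maps)
      \<comment> \<open>The group inverse is the restricted \<open>inv_into\<close>; identifying it
        with the continuous inverse \<open>g\<close> makes it a homeomorphism.\<close>
      have g_eq: "g x = inv_into ?X f x" if "x \<in> ?X" for x
        using g that bij 
        by (metis (no_types, lifting) bij_betw_inv_into_left continuous_map_image_subset_topspace homeomorphic_maps_def image_subset_iff)
      have "homeomorphic_map (full_shift S) (full_shift S) (\<lambda>x\<in>?X. inv_into ?X f x)"
        using g g_eq by (auto simp: homeomorphic_maps_map intro: homeomorphic_map_eq)
      moreover have "inv_into ?X f (shift_map x) = shift_map (inv_into ?X f x)" if "x \<in> ?X" for x
      proof -
        let ?y = "inv_into ?X f x"
        have y: "?y \<in> ?X" "f ?y = x"
          using Bij_inv_into_mem [OF fB that] bij that by (auto simp: bij_betw_inv_into_right)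
        then have "f (shift_map ?y) = shift_map x"
          using f by (auto simp: K_def)
        then show ?thesis
          using bij y shift_map_closed by (metis bij_betw_inv_into_left)
      qed
      ultimately show ?thesis
        using restrict_inv_into_Bij [OF fB] by (simp add: inv_eq [OF fB] K_def shift_map_closed)
    qed
    show "f \<otimes>\<^bsub>BijGroup ?X\<^esub> g \<in> K" if f: "f \<in> K" and g: "g \<in> K" for f g
    proof -
      have "homeomorphic_map (full_shift S) (full_shift S) (f \<circ> g)"
        using f g by (auto simp: K_def intro: homeomorphic_map_compose)
      then have "homeomorphic_map (full_shift S) (full_shift S) (compose ?X f g)"
        by (rule homeomorphic_map_eq) (simp add: compose_def)
      moreover have "g x \<in> ?X" if "x \<in> ?X" for x
        using g that Bij_imp_funcset by (force simp: K_def)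
      moreover have "compose ?X f g \<in> Bij ?X"
        using f g by (simp add: K_def compose_Bij)
      ultimately have "compose ?X f g \<in> K"
        using f g by (simp add: K_def compose_eq shift_map_closed)
      then show ?thesis
        using f g by (simp add: K_def BijGroup_def)
    qed
  qed
  then show ?thesis
    unfolding shift_aut_group_def K_def [symmetric]
    by (rule subgroup.subgroup_is_group) (rule group_BijGroup)
qed

section \<open>Actions on full shifts\<close>

text \<open>Only values on the shift space matter, and the alphabet may have any type. Locality is
  required at coordinate 0 alone, since commuting with the shift carries it to all others.\<close>

locale shift_action = group G for G :: "'g monoid" (structure) +
  fixes S :: "'s set" and act :: "'g \<Rightarrow> (nat \<Rightarrow> 's) \<Rightarrow> nat \<Rightarrow> 's"
  assumes finite_alphabet: "finite S"
    and act_closed: "\<lbrakk>g \<in> carrier G; x \<in> topspace (full_shift S)\<rbrakk> \<Longrightarrow> act g x \<in> topspace (full_shift S)"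
    and act_one: "x \<in> topspace (full_shift S) \<Longrightarrow> act \<one> x = x"
    and act_mult: "\<lbrakk>g \<in> carrier G; h \<in> carrier G; x \<in> topspace (full_shift S)\<rbrakk>
      \<Longrightarrow> act (g \<otimes> h) x = act g (act h x)"
    and act_shift: "\<lbrakk>g \<in> carrier G; x \<in> topspace (full_shift S)\<rbrakk>
      \<Longrightarrow> act g (shift_map x) = shift_map (act g x)"
    and act_local: "g \<in> carrier G \<Longrightarrow> \<exists>m. \<forall>x \<in> topspace (full_shift S). \<forall>y \<in> topspace (full_shift S).
      (\<forall>i\<le>m. x i = y i) \<longrightarrow> act g x 0 = act g y 0"
begin

text \<open>Coordinate \<open>Suc i\<close> of an image is coordinate \<open>i\<close> of the image
  of the shifted point, so each step enlarges the window by one.\<close>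

lemma act_local_at:
  assumes g: "g \<in> carrier G"
  shows "\<exists>m. \<forall>x \<in> topspace (full_shift S). \<forall>y \<in> topspace (full_shift S).
      (\<forall>k\<le>m. x k = y k) \<longrightarrow> act g x i = act g y i"
proof (induction i)
  case 0
  then show ?case
    using act_local [OF g] .
next
  case (Suc i)
  then obtain m where m: "\<And>x y. \<lbrakk>x \<in> topspace (full_shift S); y \<in> topspace (full_shift S);
      \<forall>k\<le>m. x k = y k\<rbrakk> \<Longrightarrow> act g x i = act g y i"
    by blast
  have "act g x (Suc i) = act g y (Suc i)"
    if "x \<in> topspace (full_shift S)" "y \<in> topspace (full_shift S)" "\<forall>k\<le>Suc m. x k = y k" for x y
  proof -
    have "act g (shift_map x) i = act g (shift_map y) i"
      using that by (intro m shift_map_closed) (auto simp: shift_map_def)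
    with that show ?thesis
      by (simp add: act_shift g) (simp add: shift_map_def)
  qed
  then show ?case
    by blast
qed

end

text \<open>The action is conjugated by a bijection \<open>e\<close> onto an alphabet of natural
  numbers, as the class demands. Locality of \<open>g\<close> and of \<open>inv g\<close> yields
  continuity in both directions, and faithfulness yields a trivial kernel.\<close>

lemma shift_aut_classI:
  fixes G :: "'g monoid" (structure) and S :: "'s set"
  assumes "shift_action G S act"
    and faithful: "\<And>g. \<lbrakk>g \<in> carrier G; \<And>x. x \<in> topspace (full_shift S) \<Longrightarrow> act g x = x\<rbrakk> \<Longrightarrow> g = \<one>"
  shows "G \<in> shift_aut_class (card S)"
proof -
  interpret shift_action G S act by fact
  define T where "T = {..<card S}"
  obtain e where e: "bij_betw e S T"
    using finite_alphabet ex_bij_betw_finite_nat [of S] by (auto simp: T_def atLeast0LessThan)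
  define d where "d = inv_into S e"
  have eT: "e s \<in> T" and de: "d (e s) = s" if "s \<in> S" for s
    using that e by (auto simp: d_def bij_betw_inv_into_left bij_betwE)
  have dS: "d t \<in> S" and ed: "e (d t) = t" if "t \<in> T" for t
    using that e by (auto simp: d_def bij_betw_inv_into_right bij_betwE [OF bij_betw_inv_into])
  let ?X = "topspace (full_shift S)" and ?Y = "topspace (full_shift T)"
  have dX: "d \<circ> y \<in> ?X" and edy: "e \<circ> (d \<circ> y) = y" if "y \<in> ?Y" for y
    using that by (auto simp: topspace_full_shift dS ed)
  have eY: "e \<circ> x \<in> ?Y" and dex: "d \<circ> (e \<circ> x) = x" if "x \<in> ?X" for x
    using that by (auto simp: topspace_full_shift eT de)
  define F where "F g = (\<lambda>y\<in>?Y. e \<circ> act g (d \<circ> y))" for g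
  have FY: "F g y \<in> ?Y" if "g \<in> carrier G" "y \<in> ?Y" for g y
    using that by (simp add: F_def eY dX act_closed)
  have F_mult: "F (g \<otimes> h) y = F g (F h y)" if "g \<in> carrier G" "h \<in> carrier G" "y \<in> ?Y" for g h y
    using that FY [OF that(2,3)] by (simp add: F_def dX dex act_closed act_mult)
  have F_one: "F \<one> y = y" if "y \<in> ?Y" for y
    using that by (simp add: F_def dX edy act_one)
  have F_shift: "F g (shift_map y) = shift_map (F g y)" if "g \<in> carrier G" "y \<in> ?Y" for g y
  proof -
    have "d \<circ> shift_map y = shift_map (d \<circ> y)"
      by (auto simp: shift_map_def)
    then show ?thesis
      using that by (simp add: F_def shift_map_closed dX act_shift) (auto simp: shift_map_def)
  qed
  have cont: "continuous_map (full_shift T) (full_shift T) (F g)" if g: "g \<in> carrier G" for g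
  proof (rule continuous_map_full_shift)
    show "F g y \<in> ?Y" if "y \<in> ?Y" for y
      using FY g that .
    fix i
    obtain m where m: "\<And>x y. \<lbrakk>x \<in> ?X; y \<in> ?X; \<forall>k\<le>m. x k = y k\<rbrakk> \<Longrightarrow> act g x i = act g y i"
      using act_local_at [OF g, of i] by blast
    have "F g x i = F g y i" if "x \<in> ?Y" "y \<in> ?Y" "\<forall>k\<le>m. x k = y k" for x y
      using that m [OF dX dX, of x y] by (simp add: F_def)
    then show "\<exists>m. \<forall>x \<in> ?Y. \<forall>y \<in> ?Y. (\<forall>k\<le>m. x k = y k) \<longrightarrow> F g x i = F g y i"
      by blast
  qed
  have maps: "homeomorphic_maps (full_shift T) (full_shift T) (F g) (F (inv g))" if "g \<in> carrier G" for g
    using that cont by (simp add: homeomorphic_maps_def F_one flip: F_mult)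
  have F_Bij: "F g \<in> Bij ?Y" if g: "g \<in> carrier G" for g
  proof -
    have "homeomorphic_map (full_shift T) (full_shift T) (F g)"
      using maps [OF g] by (simp add: homeomorphic_maps_map)
    then have "bij_betw (F g) ?Y ?Y"
      by (simp add: bij_betw_def homeomorphic_imp_injective_map homeomorphic_imp_surjective_map)
    then show ?thesis
      by (simp add: Bij_def F_def)
  qed
  have F_carrier: "F g \<in> carrier (shift_aut_group T)" if "g \<in> carrier G" for g
    using that F_Bij maps by (auto simp: shift_aut_group_def F_shift homeomorphic_maps_map)
  have hom: "F \<in> hom G (shift_aut_group T)"
  proof (rule homI)
    fix g h assume g: "g \<in> carrier G" and h: "h \<in> carrier G"
    have "F (g \<otimes> h) = compose ?Y (F g) (F h)"
    proof
      show "F (g \<otimes> h) y = compose ?Y (F g) (F h) y" for y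
        using F_mult [OF g h] by (cases "y \<in> ?Y") (simp_all add: compose_def, simp add: F_def)
    qed
    then show "F (g \<otimes> h) = F g \<otimes>\<^bsub>shift_aut_group T\<^esub> F h"
      using g h by (simp add: shift_aut_group_def BijGroup_def F_Bij)
  qed (rule F_carrier)
  interpret F: group_hom G "shift_aut_group T" F
    by (simp add: group_hom_def group_hom_axioms_def group_axioms group_shift_aut_group hom)
  have ker: "g = \<one>" if g: "g \<in> carrier G" and eq: "F g = \<one>\<^bsub>shift_aut_group T\<^esub>" for g
  proof (rule faithful [OF g])
    fix x assume x: "x \<in> ?X"
    have "F g (e \<circ> x) = e \<circ> x"
      using eq eY [OF x] by (simp add: shift_aut_group_def BijGroup_def)
    then have "e \<circ> act g x = e \<circ> x"
      using eY [OF x] by (simp add: F_def dex x)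
    then show "act g x = x"
      using dex [OF x] dex [OF act_closed [OF g x]] by metis
  qed
  have inj: "inj_on F (carrier G)"
    using ker F.inj_on_one_iff by blast
  have "F \<in> iso G (shift_aut_group T \<lparr>carrier := F ` carrier G\<rparr>)"
    using hom inj by (auto simp: iso_iff hom_def)
  then have "G \<cong> shift_aut_group T \<lparr>carrier := F ` carrier G\<rparr>"
    by (rule is_isoI)
  then show ?thesis
    using F.img_is_subgroup group_axioms unfolding shift_aut_class_def
    by (intro CollectI conjI exI [of _ T] exI [of _ "F ` carrier G"]) (simp_all add: T_def)
qed

section \<open>Wreath products\<close>

lemma group_semidirect_product:
  assumes "group N" "group H"
    and hom: "\<And>h. h \<in> carrier H \<Longrightarrow> \<phi> h \<in> hom N N"
    and mult: "\<And>g h a. \<lbrakk>g \<in> carrier H; h \<in> carrier H; a \<in> carrier N\<rbrakk>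
      \<Longrightarrow> \<phi> (g \<otimes>\<^bsub>H\<^esub> h) a = \<phi> g (\<phi> h a)"
    and one: "\<And>a. a \<in> carrier N \<Longrightarrow> \<phi> \<one>\<^bsub>H\<^esub> a = a"
  shows "group (semidirect_product N H \<phi>)"
proof -
  interpret N: group N by fact
  interpret H: group H by fact
  have closed: "\<phi> h a \<in> carrier N" if "h \<in> carrier H" "a \<in> carrier N" for h a
    using hom that by (auto simp: hom_def)
  have distrib: "\<phi> h (a \<otimes>\<^bsub>N\<^esub> b) = \<phi> h a \<otimes>\<^bsub>N\<^esub> \<phi> h b"
    if "h \<in> carrier H" "a \<in> carrier N" "b \<in> carrier N" for h a b
    using hom that by (auto simp: hom_def)
  show ?thesis
  proof (rule groupI)
    fix x assume "x \<in> carrier (semidirect_product N H \<phi>)"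
    then obtain a g where x: "x = (a, g)" "a \<in> carrier N" "g \<in> carrier H"
      by (auto simp: semidirect_product_def)
    let ?b = "\<phi> (inv\<^bsub>H\<^esub> g) (inv\<^bsub>N\<^esub> a)"
    have "?b \<otimes>\<^bsub>N\<^esub> \<phi> (inv\<^bsub>H\<^esub> g) a = \<phi> (inv\<^bsub>H\<^esub> g) \<one>\<^bsub>N\<^esub>"
      using x by (simp flip: distrib)
    also have "\<dots> = \<one>\<^bsub>N\<^esub>"
      using x by (intro hom_one hom) (simp_all add: assms)
    finally show "\<exists>y\<in>carrier (semidirect_product N H \<phi>).
        y \<otimes>\<^bsub>semidirect_product N H \<phi>\<^esub> x = \<one>\<^bsub>semidirect_product N H \<phi>\<^esub>"
      using x by (intro bexI [of _ "(?b, inv\<^bsub>H\<^esub> g)"]) (simp_all add: semidirect_product_def closed)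
  qed (auto simp: semidirect_product_def closed distrib mult one N.m_assoc H.m_assoc)
qed

text \<open>Even for infinite \<open>B\<close> this reduces to \<open>finprod\<close>, because
  \<open>h\<close> maps the support of the composite bijectively onto the support of
  \<open>f\<close>.\<close>

lemma (in comm_monoid) gfinprod_reindex:
  assumes "inj_on h B" "f \<in> h ` B \<rightarrow> carrier G"
  shows "gfinprod G f (h ` B) = gfinprod G (\<lambda>x. f (h x)) B"
proof -
  let ?D = "{x \<in> B. f (h x) \<noteq> \<one>}"
  have D: "{y \<in> h ` B. f y \<noteq> \<one>} = h ` ?D"
    by auto
  have inj: "inj_on h ?D"
    using assms(1) by (rule inj_on_subset) auto
  have "finprod G f (h ` ?D) = finprod G (\<lambda>x. f (h x)) ?D"
    using assms(2) inj by (intro finprod_reindex) auto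
  then show ?thesis
    unfolding gfinprod_def D by (simp add: finite_image_iff [OF inj])
qed

context shift_action
begin

text \<open>A common window for several coordinates is needed because \<open>hit_prod\<close> reads
  a whole initial segment of the moved point.\<close>

lemma act_local_upto:
  assumes g: "g \<in> carrier G"
  shows "\<exists>m. \<forall>x \<in> topspace (full_shift S). \<forall>y \<in> topspace (full_shift S).
      (\<forall>k\<le>m. x k = y k) \<longrightarrow> (\<forall>k\<le>n. act g x k = act g y k)"
proof (induction n)
  case 0
  then show ?case
    using act_local_at [OF g, of 0] by simp
next
  case (Suc n)
  then obtain m where m: "\<And>x y k. \<lbrakk>x \<in> topspace (full_shift S); y \<in> topspace (full_shift S);
      \<forall>k\<le>m. x k = y k; k \<le> n\<rbrakk> \<Longrightarrow> act g x k = act g y k"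
    by blast
  obtain m' where m': "\<And>x y. \<lbrakk>x \<in> topspace (full_shift S); y \<in> topspace (full_shift S);
      \<forall>k\<le>m'. x k = y k\<rbrakk> \<Longrightarrow> act g x (Suc n) = act g y (Suc n)"
    using act_local_at [OF g, of "Suc n"] by blast
  have "act g x k = act g y k"
    if xy: "x \<in> topspace (full_shift S)" "y \<in> topspace (full_shift S)" "\<forall>k\<le>max m m'. x k = y k"
      and k: "k \<le> Suc n" for x y k
  proof (cases "k \<le> n")
    case True
    with xy show ?thesis
      by (intro m) simp_all
  next
    case False
    with k have "k = Suc n"
      by simp
    with xy m' [of x y] show ?thesis
      by simp
  qed
  then show ?case
    by blast
qed

end

section \<open>Separating actions and the induced action of the wreath product\<close>

locale separated_shift_action = shift_action +
  fixes C :: "'b set"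
  assumes separated: "\<lbrakk>finite F; F \<noteq> {}; F \<subseteq> carrier G\<rbrakk> \<Longrightarrow>
      \<exists>x \<in> topspace (full_shift S). \<exists>g\<^sub>0 \<in> F. \<forall>g \<in> F. act g x 0 \<in> C \<longleftrightarrow> g = g\<^sub>0"
begin

text \<open>If \<open>g\<close> fixes every point, then \<open>\<one>\<close> and \<open>g\<close>
  hit the cylinder simultaneously, so separating the set of these two forces them to
  coincide.\<close>

lemma faithful:
  assumes g: "g \<in> carrier G" and "\<And>x. x \<in> topspace (full_shift S) \<Longrightarrow> act g x = x"
  shows "g = \<one>"
  using separated [of "{\<one>, g}"] assms by (auto simp: act_one)

text \<open>\<open>gfinprod\<close> is used since \<open>G\<close> may be infinite while the
  intended \<open>f\<close> have finite support.\<close>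

definition hit_prod :: "('c, 'd) monoid_scheme \<Rightarrow> ('a \<Rightarrow> 'c) \<Rightarrow> (nat \<Rightarrow> 'b) \<Rightarrow> nat \<Rightarrow> 'c"
  where "hit_prod A f x i =
    gfinprod A (\<lambda>k. if act (inv k) x i \<in> C then f k else \<one>\<^bsub>A\<^esub>) (carrier G)"

text \<open>The pair \<open>(f, g)\<close> means first \<open>g\<close>, then \<open>f\<close>;
  hence \<open>hit_prod\<close> is evaluated at the point already moved by \<open>g\<close>.\<close>

definition wreath_act :: "('c, 'd) monoid_scheme \<Rightarrow> ('a \<Rightarrow> 'c) \<times> 'a \<Rightarrow> (nat \<Rightarrow> 'b \<times> 'c) \<Rightarrow> nat \<Rightarrow> 'b \<times> 'c"
  where "wreath_act A = (\<lambda>(f, g) z i.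
    (act g (fst \<circ> z) i, snd (z i) \<otimes>\<^bsub>A\<^esub> hit_prod A f (act g (fst \<circ> z)) i))"

lemma hit_prod_shift:
  assumes "x \<in> topspace (full_shift S)" "f \<in> carrier G \<rightarrow> carrier A" "comm_monoid A"
  shows "hit_prod A f (shift_map x) i = hit_prod A f x (Suc i)"
proof -
  interpret A: comm_monoid A by fact
  show ?thesis
    unfolding hit_prod_def using assms
    by (intro A.gfinprod_cong) (auto simp: act_shift simp_implies_def, auto simp: shift_map_def)
qed

text \<open>Reindexing by \<open>k \<mapsto> g \<otimes> k\<close> works because
  \<open>inv (g \<otimes> k)\<close> takes \<open>act g x\<close> to \<open>act (inv k) x\<close>.
  This equivariance is what matches the semidirect product.\<close>

lemma hit_prod_translate:
  assumes x: "x \<in> topspace (full_shift S)" and f: "f \<in> carrier G \<rightarrow> carrier A"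
    and g: "g \<in> carrier G" and "comm_monoid A"
  shows "hit_prod A (\<lambda>k\<in>carrier G. f (inv g \<otimes> k)) (act g x) i = hit_prod A f x i"
proof -
  interpret A: comm_monoid A by fact
  let ?u = "\<lambda>k. if act (inv k) (act g x) i \<in> C then (\<lambda>k\<in>carrier G. f (inv g \<otimes> k)) k else \<one>\<^bsub>A\<^esub>"
  have surj: "(\<lambda>k. g \<otimes> k) ` carrier G = carrier G"
    using g by (rule surj_const_mult)
  have uA: "?u \<in> carrier G \<rightarrow> carrier A"
    using f g by (auto simp: Pi_iff)
  have "gfinprod A ?u ((\<lambda>k. g \<otimes> k) ` carrier G) = gfinprod A (\<lambda>k. ?u (g \<otimes> k)) (carrier G)"
    using g uA by (intro A.gfinprod_reindex inj_on_cmult) (simp_all add: surj)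
  also have "\<dots> = hit_prod A f x i"
    unfolding hit_prod_def
  proof (rule A.gfinprod_cong [unfolded simp_implies_def])
    fix k assume k: "k \<in> carrier G"
    have "act (inv (g \<otimes> k)) (act g x) = act (inv k) x"
      using k g x by (simp add: inv_mult_group m_assoc flip: act_mult)
    moreover have "inv g \<otimes> (g \<otimes> k) = k"
      using k g by (simp flip: m_assoc)
    ultimately show "?u (g \<otimes> k) = (if act (inv k) x i \<in> C then f k else \<one>\<^bsub>A\<^esub>)"
      using k g by simp
  next
    show "(\<lambda>k. ?u (g \<otimes> k)) \<in> carrier G \<rightarrow> carrier A"
      by (rule Pi_I, rule funcset_mem [OF uA], rule m_closed [OF g])
  qed simp
  finally show ?thesis
    by (simp add: surj hit_prod_def)
qed

text \<open>For fixed \<open>x\<close> and \<open>i\<close> each coordinate undergoes the identity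
  or the trivial map, and a product of homomorphisms into an abelian group is again one.\<close>

lemma hit_prod_hom:
  assumes "comm_group A"
  shows "(\<lambda>f. hit_prod A f x i) \<in> hom (sum_group (carrier G) (\<lambda>_. A)) A"
proof -
  interpret A: comm_group A by fact
  have "(\<lambda>f. gfinprod A (\<lambda>k. (\<lambda>a. if act (inv k) x i \<in> C then a else \<one>\<^bsub>A\<^esub>) (f k)) (carrier G))
      \<in> hom (sum_group (carrier G) (\<lambda>_. A)) A"
    by (rule A.hom_group_sum) (auto simp: hom_def A.is_group)
  then show ?thesis
    by (simp add: hit_prod_def)
qed

lemma hit_prod_local:
  assumes f: "f \<in> carrier (sum_group (carrier G) (\<lambda>_. A))" and "comm_group A"
  shows "\<exists>m. \<forall>x \<in> topspace (full_shift S). \<forall>y \<in> topspace (full_shift S).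
      (\<forall>k\<le>m. x k = y k) \<longrightarrow> hit_prod A f x 0 = hit_prod A f y 0"
proof -
  interpret A: comm_group A by fact
  let ?D = "{k \<in> carrier G. f k \<noteq> \<one>\<^bsub>A\<^esub>}"
  have fin: "finite ?D" and fA: "f \<in> carrier G \<rightarrow> carrier A"
    using f by (auto simp: carrier_sum_group A.is_group PiE_iff)
  obtain m where m: "\<And>k x y. \<lbrakk>k \<in> carrier G; x \<in> topspace (full_shift S); y \<in> topspace (full_shift S);
      \<forall>l\<le>m k. x l = y l\<rbrakk> \<Longrightarrow> act (inv k) x 0 = act (inv k) y 0"
    using act_local [OF inv_closed] by metis
  \<comment> \<open>Only the finite support contributes, so the largest of its windows suffices; the
    inserted 0 covers empty support.\<close>
  define M where "M = Max (insert 0 (m ` ?D))"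
  have M: "m k \<le> M" if "k \<in> ?D" for k
    unfolding M_def using fin that by (intro Max_ge) auto
  have "hit_prod A f x 0 = hit_prod A f y 0"
    if xy: "x \<in> topspace (full_shift S)" "y \<in> topspace (full_shift S)" "\<forall>k\<le>M. x k = y k" for x y
    unfolding hit_prod_def
  proof (rule A.gfinprod_cong [unfolded simp_implies_def])
    fix k assume k: "k \<in> carrier G"
    show "(if act (inv k) x 0 \<in> C then f k else \<one>\<^bsub>A\<^esub>) = (if act (inv k) y 0 \<in> C then f k else \<one>\<^bsub>A\<^esub>)"
    proof (cases "k \<in> ?D")
      case True
      then have "act (inv k) x 0 = act (inv k) y 0"
        using M [OF True] xy k by (intro m) auto
      then show ?thesis
        by simp
    qed (use k in auto)
  qed (use fA in auto)
  then show ?thesis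
    by blast
qed

lemma wreath_product_in_class:
  fixes A :: "('c, 'd) monoid_scheme"
  assumes "comm_group A" and fin_A: "finite (carrier A)" and card: "2 \<le> card S"
  shows "wreath_product A G \<in> shift_aut_class_inf"
proof -
  interpret A: comm_group A by fact
  let ?N = "sum_group (carrier G) (\<lambda>_. A)" and ?W = "wreath_product A G"
    and ?T = "S \<times> carrier A"
  let ?X = "topspace (full_shift S)" and ?Z = "topspace (full_shift ?T)"
  let ?tr = "\<lambda>g f. \<lambda>x\<in>carrier G. f (inv g \<otimes> x)"
  have N: "f \<in> carrier ?N \<longleftrightarrow> f \<in> carrier G \<rightarrow>\<^sub>E carrier A \<and> finite {k \<in> carrier G. f k \<noteq> \<one>\<^bsub>A\<^esub>}" for f
    by (simp add: carrier_sum_group A.is_group)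
  have tr_closed: "?tr g f \<in> carrier ?N" if g: "g \<in> carrier G" and f: "f \<in> carrier ?N" for g f
  proof -
    \<comment> \<open>Translation by \<open>g\<close> moves the support by left multiplication,
      which keeps it finite.\<close>
    have "{k \<in> carrier G. ?tr g f k \<noteq> \<one>\<^bsub>A\<^esub>} \<subseteq> (\<lambda>k. g \<otimes> k) ` {k \<in> carrier G. f k \<noteq> \<one>\<^bsub>A\<^esub>}"
    proof
      fix k assume "k \<in> {k \<in> carrier G. ?tr g f k \<noteq> \<one>\<^bsub>A\<^esub>}"
      then show "k \<in> (\<lambda>k. g \<otimes> k) ` {k \<in> carrier G. f k \<noteq> \<one>\<^bsub>A\<^esub>}"
        using g by (intro image_eqI [of _ _ "inv g \<otimes> k"]) (auto simp flip: m_assoc)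
    qed
    then have "finite {k \<in> carrier G. ?tr g f k \<noteq> \<one>\<^bsub>A\<^esub>}"
      by (rule finite_subset) (use f N in blast)
    then show ?thesis
      using f g unfolding N by (intro conjI) auto
  qed
  have tr_hom: "?tr g \<in> hom ?N ?N" if g: "g \<in> carrier G" for g
    using g by (intro homI tr_closed) (auto simp: tr_closed)
  have group_W: "group ?W"
    unfolding wreath_product_def
  proof (rule group_semidirect_product)
    show "?tr (g \<otimes> h) f = ?tr g (?tr h f)"
      if "g \<in> carrier G" "h \<in> carrier G" "f \<in> carrier ?N" for g h f
      using that by (auto simp: inv_mult_group m_assoc)
    show "?tr \<one> f = f" if "f \<in> carrier ?N" for f
      using that by (auto simp: N PiE_iff extensional_def)
  qed (simp_all add: A.is_group is_group tr_hom)
  interpret W: group ?W by fact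
  have carrier_W: "carrier ?W = carrier ?N \<times> carrier G"
    and mult_W: "(f, g) \<otimes>\<^bsub>?W\<^esub> (f', g') = (f \<otimes>\<^bsub>?N\<^esub> ?tr g f', g \<otimes> g')"
    and one_W: "\<one>\<^bsub>?W\<^esub> = (\<one>\<^bsub>?N\<^esub>, \<one>)" for f g f' g'
    by (simp_all add: wreath_product_def semidirect_product_def)
  have Z: "z \<in> ?Z \<longleftrightarrow> fst \<circ> z \<in> ?X \<and> (\<forall>i. snd (z i) \<in> carrier A)" for z
    by (auto simp: topspace_full_shift mem_Times_iff)
  have funN: "f \<in> carrier G \<rightarrow> carrier A" if "f \<in> carrier ?N" for f
    using that by (auto simp: N)
  have hp_closed: "hit_prod A f x i \<in> carrier A" if "f \<in> carrier ?N" for f x i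
    using that hit_prod_hom [OF assms(1)] by (auto simp: hom_def)
  have hp_mult: "hit_prod A (f \<otimes>\<^bsub>?N\<^esub> f') x i = hit_prod A f x i \<otimes>\<^bsub>A\<^esub> hit_prod A f' x i"
    if "f \<in> carrier ?N" "f' \<in> carrier ?N" for f f' x i
    using that hit_prod_hom [OF assms(1)] by (rule hom_mult [rotated])
  have hp_one: "hit_prod A \<one>\<^bsub>?N\<^esub> x i = \<one>\<^bsub>A\<^esub>" for x i
    by (rule hom_one [OF hit_prod_hom [OF assms(1)]]) (simp_all add: A.is_group)
  have fst_act: "fst \<circ> wreath_act A (f, g) z = act g (fst \<circ> z)" for f g z
    by (auto simp: wreath_act_def)
  have act_W: "shift_action ?W ?T (wreath_act A)"
  proof (intro shift_action.intro shift_action_axioms.intro)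
    show "finite ?T"
      using finite_alphabet fin_A by simp
    show "wreath_act A w z \<in> ?Z" if "w \<in> carrier ?W" "z \<in> ?Z" for w z
      using that by (cases w) (auto simp: Z carrier_W fst_act act_closed, auto simp: wreath_act_def hp_closed)
    show "wreath_act A \<one>\<^bsub>?W\<^esub> z = z" if "z \<in> ?Z" for z
      using that hp_one by (auto simp: wreath_act_def one_W Z act_one)
    show "wreath_act A (v \<otimes>\<^bsub>?W\<^esub> w) z = wreath_act A v (wreath_act A w z)"
      if v: "v \<in> carrier ?W" and w: "w \<in> carrier ?W" and z: "z \<in> ?Z" for v w z
    proof -
      obtain f g where fg: "v = (f, g)" "f \<in> carrier ?N" "g \<in> carrier G"
        using v by (auto simp: carrier_W)
      obtain f' g' where fg': "w = (f', g')" "f' \<in> carrier ?N" "g' \<in> carrier G"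
        using w by (auto simp: carrier_W)
      let ?x = "act g' (fst \<circ> z)"
      have x: "?x \<in> ?X"
        using z fg' by (simp add: Z act_closed)
      \<comment> \<open>Translation lets \<open>f'\<close> be read off before \<open>g\<close> acts;
        commutativity of \<open>A\<close> then puts the factors in the order in which the two maps
        are applied.\<close>
      have "hit_prod A (f \<otimes>\<^bsub>?N\<^esub> ?tr g f') (act g ?x) i
          = hit_prod A f' ?x i \<otimes>\<^bsub>A\<^esub> hit_prod A f (act g ?x) i" for i
        using fg fg' x tr_closed funN A.comm_monoid_axioms
        by (simp add: hp_mult hp_closed hit_prod_translate A.m_comm del: mult_sum_group)
      then show ?thesis
        using z fg fg' unfolding fg(1) fg'(1) mult_W
        by (auto simp: wreath_act_def fst_act act_mult Z hp_closed A.m_assoc comp_def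
            simp del: mult_sum_group simp flip: fst_act)
    qed
    show "wreath_act A w (shift_map z) = shift_map (wreath_act A w z)"
      if w: "w \<in> carrier ?W" and z: "z \<in> ?Z" for w z
    proof -
      obtain f g where fg: "w = (f, g)" "f \<in> carrier ?N" "g \<in> carrier G"
        using w by (auto simp: carrier_W)
      have "fst \<circ> shift_map z = shift_map (fst \<circ> z)"
        by (auto simp: shift_map_def)
      then have "act g (fst \<circ> shift_map z) = shift_map (act g (fst \<circ> z))"
        using z fg by (simp add: Z act_shift)
      then show ?thesis
        using z fg by (auto simp: wreath_act_def Z hit_prod_shift act_closed funN A.comm_monoid_axioms)
          (auto simp: shift_map_def)
    qed
    show "\<exists>m. \<forall>x\<in>?Z. \<forall>y\<in>?Z. (\<forall>i\<le>m. x i = y i) \<longrightarrow> wreath_act A w x 0 = wreath_act A w y 0"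
      if w: "w \<in> carrier ?W" for w
    proof -
      obtain f g where fg: "w = (f, g)" "f \<in> carrier ?N" "g \<in> carrier G"
        using w by (auto simp: carrier_W)
      \<comment> \<open>Windows compose: \<open>n\<close> coordinates after \<open>g\<close> has
        acted determine the product, and \<open>m\<close> coordinates before determine
        those.\<close>
      obtain n where n: "\<And>x y. \<lbrakk>x \<in> ?X; y \<in> ?X; \<forall>k\<le>n. x k = y k\<rbrakk> \<Longrightarrow> hit_prod A f x 0 = hit_prod A f y 0"
        using hit_prod_local [OF fg(2) assms(1)] by blast
      obtain m where m: "\<And>x y. \<lbrakk>x \<in> ?X; y \<in> ?X; \<forall>k\<le>m. x k = y k\<rbrakk> \<Longrightarrow> \<forall>k\<le>n. act g x k = act g y k"
        using act_local_upto [OF fg(3), of n] by blast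
      have "wreath_act A w x 0 = wreath_act A w y 0" if "x \<in> ?Z" "y \<in> ?Z" "\<forall>i\<le>m. x i = y i" for x y
      proof -
        have eq: "\<forall>k\<le>n. act g (fst \<circ> x) k = act g (fst \<circ> y) k"
          using that by (intro m) (auto simp: Z)
        moreover from eq have "hit_prod A f (act g (fst \<circ> x)) 0 = hit_prod A f (act g (fst \<circ> y)) 0"
          using that fg by (intro n act_closed) (auto simp: Z)
        ultimately show ?thesis
          using that by (simp add: wreath_act_def fg(1))
      qed
      then show ?thesis
        by blast
    qed
  qed (fact group_W)
  have "?W \<in> shift_aut_class (card ?T)"
  proof (rule shift_aut_classI [OF act_W])
    fix w assume w: "w \<in> carrier ?W" and id: "\<And>z. z \<in> ?Z \<Longrightarrow> wreath_act A w z = z"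
    obtain f g where fg: "w = (f, g)" "f \<in> carrier ?N" "g \<in> carrier G"
      using w by (auto simp: carrier_W)
    have on_base: "act g x = x \<and> hit_prod A f (act g x) i = \<one>\<^bsub>A\<^esub>" if x: "x \<in> ?X" for x i
    proof -
      \<comment> \<open>With trivial second coordinates the image displays \<open>hit_prod\<close>
        itself.\<close>
      define z where "z = (\<lambda>i. (x i, \<one>\<^bsub>A\<^esub>))"
      have fz: "fst \<circ> z = x"
        by (auto simp: z_def)
      then have "wreath_act A w z = z"
        using x by (intro id) (simp add: Z, simp add: z_def)
      then have eq: "wreath_act A w z i = (x i, \<one>\<^bsub>A\<^esub>)" for i
        by (simp add: z_def)
      have "act g x i = x i \<and> hit_prod A f (act g x) i = \<one>\<^bsub>A\<^esub>" for i
        using eq [of i] hp_closed [OF fg(2)] by (simp add: fg(1) wreath_act_def fz) (simp add: z_def)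
      then show ?thesis
        by blast
    qed
    have g: "g = \<one>"
      using on_base fg by (intro faithful) auto
    have "{k \<in> carrier G. f k \<noteq> \<one>\<^bsub>A\<^esub>} = {}"
    proof (rule ccontr)
      let ?D = "{k \<in> carrier G. f k \<noteq> \<one>\<^bsub>A\<^esub>}"
      assume "?D \<noteq> {}"
      moreover have fin: "finite ?D"
        using fg by (simp add: N)
      \<comment> \<open>Separation is applied to the inverses of the support because
        \<open>hit_prod\<close> tests \<open>inv k\<close>; a single factor
        \<open>f k\<^sub>0\<close> survives at \<open>x\<close>.\<close>
      ultimately obtain x h where x: "x \<in> ?X" and h: "h \<in> m_inv G ` ?D"
        and hit: "\<forall>k \<in> m_inv G ` ?D. act k x 0 \<in> C \<longleftrightarrow> k = h"
        using separated [of "m_inv G ` ?D"] by auto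
      then obtain k\<^sub>0 where k\<^sub>0: "k\<^sub>0 \<in> ?D" "h = inv k\<^sub>0"
        by auto
      have fA: "f \<in> carrier G \<rightarrow> carrier A"
        using fg funN by simp
      have "hit_prod A f x 0 = gfinprod A (\<lambda>k. if k = k\<^sub>0 then f k else \<one>\<^bsub>A\<^esub>) ?D"
        unfolding hit_prod_def
      proof (rule A.gfinprod_mono_neutral_cong_right)
        fix k assume "k \<in> ?D"
        then have "act (inv k) x 0 \<in> C \<longleftrightarrow> k = k\<^sub>0"
          using hit k\<^sub>0 by (metis (mono_tags, lifting) image_eqI inv_inv mem_Collect_eq)
        then show "(if act (inv k) x 0 \<in> C then f k else \<one>\<^bsub>A\<^esub>) = (if k = k\<^sub>0 then f k else \<one>\<^bsub>A\<^esub>)"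
          by simp
      qed (use fA in auto)
      also have "\<dots> = f k\<^sub>0"
        using fin k\<^sub>0 fA by (subst A.gfinprod_eq_finprod) (auto intro: A.finprod_singleton_swap)
      finally have "hit_prod A f x 0 = f k\<^sub>0" .
      moreover have "hit_prod A f x 0 = \<one>\<^bsub>A\<^esub>"
        using on_base [OF x, of 0] by metis
      ultimately show False
        using k\<^sub>0 by simp
    qed
    then have "f = \<one>\<^bsub>?N\<^esub>"
      using fg by (fastforce simp: N PiE_iff extensional_def)
    then show "w = \<one>\<^bsub>?W\<^esub>"
      by (simp add: fg(1) g one_W)
  qed
  moreover have "2 \<le> card ?T"
  proof -
    have "card (carrier A) \<noteq> 0"
      using fin_A A.one_closed by auto
    then show ?thesis
      using card by (cases "card (carrier A)") (auto simp: card_cartesian_product)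
  qed
  ultimately show ?thesis
    unfolding shift_aut_class_inf_def by blast
qed

end

section \<open>Free groups\<close>

lemma inv_letter_inv_letter [simp]: "inv_letter (inv_letter a) = a"
  by (simp add: inv_letter_def)

lemma inv_letter_neq [simp]: "inv_letter a \<noteq> a" "a \<noteq> inv_letter a"
  by (auto simp: inv_letter_def prod_eq_iff)

lemma inv_letter_mem_iff [simp]: "inv_letter a \<in> gens \<times> UNIV \<longleftrightarrow> a \<in> gens \<times> UNIV"
  by (simp add: inv_letter_def mem_Times_iff)

lemma reduced_word_Nil [simp]: "reduced_word []"
  by (simp add: reduced_word_def)

lemma reduced_word_Cons:
  "reduced_word (a # w) \<longleftrightarrow> (w = [] \<or> hd w \<noteq> inv_letter a) \<and> reduced_word w"
proof (cases w)
  case (Cons b v)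
  then show ?thesis
    by (auto simp: reduced_word_def nth_Cons split: nat.splits)
qed (simp add: reduced_word_def)

lemma cons_reduce_reduced: "reduced_word w \<Longrightarrow> reduced_word (cons_reduce a w)"
  by (cases w) (auto simp: reduced_word_Cons)

lemma cons_reduce_lists: "\<lbrakk>a \<in> L; w \<in> lists L\<rbrakk> \<Longrightarrow> cons_reduce a w \<in> lists L"
  by (cases w) auto

text \<open>If \<open>w\<close> starts with \<open>a\<close>, that letter is cancelled first;
  reducedness of \<open>w\<close> ensures that putting it back causes no further
  cancellation.\<close>

lemma cons_reduce_cancel:
  assumes "reduced_word w"
  shows "cons_reduce a (cons_reduce (inv_letter a) w) = w"
proof (cases w)
  case (Cons b v)
  then show ?thesis
    using assms by (cases v) (auto simp: reduced_word_Cons)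
qed simp

lemma foldr_cons_reduce_lists: "\<lbrakk>u \<in> lists L; w \<in> lists L\<rbrakk> \<Longrightarrow> foldr cons_reduce u w \<in> lists L"
  by (induction u) (simp_all add: cons_reduce_lists del: in_lists_conv_set)

lemma foldr_cons_reduce_reduced: "reduced_word w \<Longrightarrow> reduced_word (foldr cons_reduce u w)"
  by (induction u) (auto intro: cons_reduce_reduced)

text \<open>Cancelling a letter against its inverse does not change how a word acts. This serves
  both associativity of the free group, with \<open>f\<close> being \<open>cons_reduce\<close>, and
  the action by flips.\<close>

lemma foldr_foldr_cons_reduce:
  assumes closed: "\<And>a y. \<lbrakk>a \<in> L; y \<in> Y\<rbrakk> \<Longrightarrow> f a y \<in> Y"
    and cancel: "\<And>a y. \<lbrakk>a \<in> L; y \<in> Y\<rbrakk> \<Longrightarrow> f a (f (inv_letter a) y) = y"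
    and u: "u \<in> lists L" and v: "v \<in> lists L" and y: "y \<in> Y"
  shows "foldr f (foldr cons_reduce u v) y = foldr f u (foldr f v y)"
proof -
  have foldr_closed: "foldr f w y \<in> Y" if "w \<in> lists L" for w
    using that by (induction w) (auto simp: y closed)
  have step: "foldr f (cons_reduce a w) y = f a (foldr f w y)" if "a \<in> L" "w \<in> lists L" for a w
    using that by (cases w) (auto simp: cancel foldr_closed)
  show ?thesis
    using u by (induction u) (auto simp: step foldr_cons_reduce_lists v)
qed

lemma group_free_group: "group (free_group gens)"
proof (rule groupI)
  let ?F = "free_group gens"
  have F: "w \<in> carrier ?F \<longleftrightarrow> w \<in> lists (gens \<times> UNIV) \<and> reduced_word w" for w
    by (simp add: free_group_def)
  have mult: "u \<otimes>\<^bsub>?F\<^esub> v = foldr cons_reduce u v" and one: "\<one>\<^bsub>?F\<^esub> = []" for u v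
    by (simp_all add: free_group_def)
  show closed: "u \<otimes>\<^bsub>?F\<^esub> v \<in> carrier ?F" if "u \<in> carrier ?F" "v \<in> carrier ?F" for u v
    using that unfolding F mult by (intro conjI foldr_cons_reduce_lists foldr_cons_reduce_reduced) simp_all
  show assoc: "u \<otimes>\<^bsub>?F\<^esub> v \<otimes>\<^bsub>?F\<^esub> w = u \<otimes>\<^bsub>?F\<^esub> (v \<otimes>\<^bsub>?F\<^esub> w)"
    if "u \<in> carrier ?F" "v \<in> carrier ?F" "w \<in> carrier ?F" for u v w
    unfolding mult
    by (rule foldr_foldr_cons_reduce [where L = "gens \<times> UNIV" and Y = "Collect reduced_word"])
      (use that in \<open>auto simp: F cons_reduce_reduced cons_reduce_cancel\<close>)
  show "\<exists>v\<in>carrier ?F. v \<otimes>\<^bsub>?F\<^esub> w = \<one>\<^bsub>?F\<^esub>" if "w \<in> carrier ?F" for w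
    using that
  proof (induction w)
    case Nil
    then show ?case
      by (intro bexI [of _ "[]"]) (simp_all add: F mult one)
  next
    case (Cons a w)
    have a: "[inv_letter a] \<in> carrier ?F" and w: "w \<in> carrier ?F"
      using Cons.prems by (simp_all add: F reduced_word_Cons)
    then obtain v where v: "v \<in> carrier ?F" "v \<otimes>\<^bsub>?F\<^esub> w = \<one>\<^bsub>?F\<^esub>"
      using Cons.IH by blast
    \<comment> \<open>Cancelling the first letter and then multiplying by the left inverse of the
      rest gives a left inverse of the whole word.\<close>
    have "[inv_letter a] \<otimes>\<^bsub>?F\<^esub> (a # w) = w"
      by (simp add: mult)
    then have "v \<otimes>\<^bsub>?F\<^esub> [inv_letter a] \<otimes>\<^bsub>?F\<^esub> (a # w) = \<one>\<^bsub>?F\<^esub>"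
      using assoc [OF v(1) a Cons.prems] v(2) by simp
    then show ?case
      using closed [OF v(1) a] by blast
  qed
qed (simp_all add: free_group_def)

section \<open>Flips of labelled columns and subsequence detection\<close>

text \<open>A configuration carries in each column a letter that never changes and a bit. The
  involution \<^term>\<open>flip a\<close> adds the bit of the next column to those columns whose letter is
  \<^term>\<open>a\<close>; excluding a next column with the same letter makes it an involution.\<close>

definition flip :: "'l \<Rightarrow> (nat \<Rightarrow> 'l option \<times> bool) \<Rightarrow> nat \<Rightarrow> 'l option \<times> bool"
  where "flip a x = (\<lambda>i. (fst (x i),
    snd (x i) \<noteq> (fst (x i) = Some a \<and> fst (x (Suc i)) \<noteq> Some a \<and> snd (x (Suc i)))))"

lemma flip_flip [simp]: "flip a (flip a x) = x"
  by (auto simp: flip_def fun_eq_iff prod_eq_iff)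

lemma fst_foldr_flip [simp]: "fst (foldr flip w x i) = fst (x i)"
  by (induction w) (simp_all add: flip_def)

lemma foldr_flip_shift: "foldr flip w (shift_map x) = shift_map (foldr flip w x)"
  by (induction w) (simp_all add: flip_def shift_map_def)

text \<open>Each flip looks one column to the right, so the window grows by one per letter.\<close>

lemma foldr_flip_local:
  "(\<And>k. k \<le> i + length w \<Longrightarrow> x k = y k) \<Longrightarrow> foldr flip w x i = foldr flip w y i"
proof (induction w arbitrary: i)
  case (Cons a w)
  have "foldr flip w x i = foldr flip w y i" "foldr flip w x (Suc i) = foldr flip w y (Suc i)"
    using Cons.prems by (auto intro: Cons.IH)
  moreover have "x i = y i" "x (Suc i) = y (Suc i)"
    using Cons.prems by simp_all
  ultimately show ?case
    by (simp add: flip_def [of a])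
qed simp

text \<open>The bits \<open>True\<close> behind the word seed the count; their label
  \<open>None\<close> protects them from every flip.\<close>

definition test_point :: "'l list \<Rightarrow> nat \<Rightarrow> 'l option \<times> bool"
  where "test_point u i = (if i < length u then (Some (u ! i), False) else (None, True))"

text \<open>The bit in column \<^term>\<open>i\<close> is the parity of the number of occurrences of
  \<^term>\<open>drop i u\<close> as a subsequence of \<^term>\<open>w\<close>; a word \<^term>\<open>w\<close> that is not longer than
  \<^term>\<open>drop i u\<close> contains it only by being equal to it.\<close>

lemma foldr_flip_test_point:
  assumes u: "distinct_adj u" and "i \<le> length u" "length w \<le> length u - i"
  shows "snd (foldr flip w (test_point u) i) \<longleftrightarrow> w = drop i u"
  using assms(2,3)
proof (induction w arbitrary: i)
  case Nil
  then show ?case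
    by (auto simp: test_point_def)
next
  case (Cons a w)
  then have i: "i < length u"
    by simp
  \<comment> \<open>By induction at \<open>i\<close>: \<open>w\<close> is strictly shorter than
    \<open>drop i u\<close>, so the bit is still clear before \<open>a\<close> acts.\<close>
  have "\<not> snd (foldr flip w (test_point u) i)"
    using Cons by auto
  moreover have "snd (foldr flip w (test_point u) (Suc i)) \<longleftrightarrow> w = drop (Suc i) u"
    using Cons by auto
  \<comment> \<open>Distinct neighbours keep the exclusion in \<open>flip\<close> from blocking the
    transfer from column \<open>Suc i\<close>.\<close>
  moreover have "fst (test_point u (Suc i)) \<noteq> Some (u ! i)"
    using distinct_adj_nth [OF u, of i] by (auto simp: test_point_def)
  moreover have "fst (test_point u i) = Some (u ! i)"
    using i by (simp add: test_point_def)
  ultimately show ?case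
    using i by (auto simp: flip_def [of a] Cons_nth_drop_Suc [symmetric])
qed

text \<open>Each signed letter \<^term>\<open>a\<close> gives an involution, so \<^term>\<open>a\<close> followed by
  \<^term>\<open>inv_letter a\<close> spells the image of a generator under an embedding of the free group into a
  free product of groups of order two.\<close>

definition double_word :: "('x \<times> bool) list \<Rightarrow> ('x \<times> bool) list"
  where "double_word w = concat (map (\<lambda>a. [a, inv_letter a]) w)"

lemma double_word_simps [simp]:
  "double_word [] = []" "double_word (a # w) = a # inv_letter a # double_word w"
  by (simp_all add: double_word_def)

lemma length_double_word [simp]: "length (double_word w) = 2 * length w"
  by (induction w) simp_all

lemma double_word_eq_iff [simp]: "double_word v = double_word w \<longleftrightarrow> v = w"
proof (induction v arbitrary: w)
  case Nil
  then show ?case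
    by (cases w) simp_all
next
  case (Cons a v)
  then show ?case
    by (cases w) auto
qed

lemma double_word_lists: "w \<in> lists (gens \<times> UNIV) \<Longrightarrow> double_word w \<in> lists (gens \<times> UNIV)"
  by (induction w) auto

text \<open>Inside a pair a letter meets its inverse; between pairs, \<open>inv_letter a\<close>
  would meet an equal letter only if the original word were not reduced.\<close>

lemma distinct_adj_double_word: "reduced_word w \<Longrightarrow> distinct_adj (double_word w)"
proof (induction w)
  case (Cons a w)
  then show ?case
    by (cases w) (auto simp: reduced_word_Cons)
qed simp

text \<open>Since flips are involutions, the pairs for \<open>a\<close> and for
  \<open>inv_letter a\<close> act as mutually inverse maps, so free reduction is harmless.\<close>

lemma foldr_flip_double_word_mult:
  "foldr flip (double_word (foldr cons_reduce u v)) x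
    = foldr flip (double_word u) (foldr flip (double_word v) x)"
proof -
  have eq: "foldr flip (double_word w) y = foldr (\<lambda>a y. flip a (flip (inv_letter a) y)) w y" for w y
    by (induction w) simp_all
  show ?thesis
    unfolding eq by (rule foldr_foldr_cons_reduce [where L = UNIV and Y = UNIV]) simp_all
qed

text \<open>The maps \<open>\<pi> t\<close> jointly embed \<open>G\<close> in a finite product of
  free groups. A letter bundles one column per track, track \<open>t\<close> moves by the doubled
  word of \<open>\<pi> t g\<close>, and the cylinder asks for the bit 1 on all tracks.\<close>

lemma wreath_product_in_class_if_free_factors:
  fixes G :: "'g monoid" and \<pi> :: "'t \<Rightarrow> 'g \<Rightarrow> ('x \<times> bool) list" and A :: "('a, 'b) monoid_scheme"
  assumes "comm_group A" "finite (carrier A)" and "group G"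
    and fin: "finite gens" "finite T" and "T \<noteq> {}"
    and hom: "\<And>t. t \<in> T \<Longrightarrow> \<pi> t \<in> hom G (free_group gens)"
    and inj: "\<And>g h. \<lbrakk>g \<in> carrier G; h \<in> carrier G; \<And>t. t \<in> T \<Longrightarrow> \<pi> t g = \<pi> t h\<rbrakk> \<Longrightarrow> g = h"
  shows "wreath_product A G \<in> shift_aut_class_inf"
proof -
  interpret G: group G by fact
  define Q where "Q = insert None (Some ` (gens \<times> (UNIV :: bool set))) \<times> (UNIV :: bool set)"
  define S where "S = (\<Pi>\<^sub>E t\<in>T. Q)"
  define act where "act g x = (\<lambda>i. \<lambda>t\<in>T. foldr flip (double_word (\<pi> t g)) (\<lambda>k. x k t) i)" for g x
  let ?X = "topspace (full_shift S)"
  have word: "\<pi> t g \<in> lists (gens \<times> UNIV)" "reduced_word (\<pi> t g)" if "t \<in> T" "g \<in> carrier G" for t g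
    using hom [OF that(1)] that(2) by (auto simp: hom_def free_group_def)
  have word_mult: "\<pi> t (g \<otimes>\<^bsub>G\<^esub> h) = foldr cons_reduce (\<pi> t g) (\<pi> t h)"
    if "t \<in> T" "g \<in> carrier G" "h \<in> carrier G" for t g h
    using hom [OF that(1)] that by (simp add: hom_def free_group_def)
  have word_one: "\<pi> t \<one>\<^bsub>G\<^esub> = []" if "t \<in> T" for t
    using hom_one [OF hom [OF that] G.is_group group_free_group] by (simp add: free_group_def)
  have X: "x \<in> ?X \<longleftrightarrow> (\<forall>i. x i \<in> extensional T \<and> (\<forall>t\<in>T. fst (x i t) \<in> insert None (Some ` (gens \<times> UNIV))))"
    for x
    by (auto simp: topspace_full_shift S_def Q_def PiE_iff mem_Times_iff)
  interpret separated_shift_action G S act "{s. \<forall>t\<in>T. snd (s t)}"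
  proof unfold_locales
    show "finite S"
      using fin by (simp add: S_def Q_def finite_PiE)
    show "act g x \<in> ?X" if "g \<in> carrier G" "x \<in> ?X" for g x
      using that by (simp add: X act_def)
    show "act \<one>\<^bsub>G\<^esub> x = x" if "x \<in> ?X" for x
      using that by (auto simp: X act_def word_one fun_eq_iff extensional_def)
    show "act (g \<otimes>\<^bsub>G\<^esub> h) x = act g (act h x)"
      if "g \<in> carrier G" "h \<in> carrier G" "x \<in> ?X" for g h x
      using that by (auto simp: act_def word_mult foldr_flip_double_word_mult intro!: restrict_ext)
    show "act g (shift_map x) = shift_map (act g x)" if "g \<in> carrier G" "x \<in> ?X" for g x
    proof -
      have "foldr flip w (\<lambda>k. shift_map x k t) i = foldr flip w (\<lambda>k. x k t) (Suc i)" for w t i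
        using foldr_flip_shift [of w "\<lambda>k. x k t"] by (simp add: shift_map_def fun_eq_iff)
      then show ?thesis
        by (simp add: act_def) (simp add: shift_map_def)
    qed
    show "\<exists>m. \<forall>x\<in>?X. \<forall>y\<in>?X. (\<forall>i\<le>m. x i = y i) \<longrightarrow> act g x 0 = act g y 0"
      if "g \<in> carrier G" for g
    proof (intro exI ballI impI)
      fix x y :: "nat \<Rightarrow> 't \<Rightarrow> ('x \<times> bool) option \<times> bool"
      \<comment> \<open>The total length of the doubled words bounds the window of every track at
        once.\<close>
      assume eq: "\<forall>i \<le> (\<Sum>t\<in>T. length (double_word (\<pi> t g))). x i = y i"
      have "foldr flip (double_word (\<pi> t g)) (\<lambda>k. x k t) 0 = foldr flip (double_word (\<pi> t g)) (\<lambda>k. y k t) 0"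
        if "t \<in> T" for t
      proof (rule foldr_flip_local)
        have "length (double_word (\<pi> t g)) \<le> (\<Sum>t\<in>T. length (double_word (\<pi> t g)))"
          using fin that by (intro member_le_sum) auto
        then show "x k t = y k t" if "k \<le> 0 + length (double_word (\<pi> t g))" for k
          using eq that by simp
      qed
      then show "act g x 0 = act g y 0"
        by (auto simp: act_def)
    qed
    fix F assume F: "finite F" "F \<noteq> {}" "F \<subseteq> carrier G"
    define len where "len g = (\<Sum>t\<in>T. length (\<pi> t g))" for g
    \<comment> \<open>The test point of \<open>g\<^sub>0\<close> controls a track only on words not longer than that of \<open>g\<^sub>0\<close>;
      by maximality every other \<open>g\<close> has such a track on which it differs from \<open>g\<^sub>0\<close>.\<close>
    obtain g\<^sub>0 where g\<^sub>0: "g\<^sub>0 \<in> F" and max: "\<And>g. g \<in> F \<Longrightarrow> len g \<le> len g\<^sub>0"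
    proof -
      have "Max (len ` F) \<in> len ` F"
        using F by simp
      then obtain g\<^sub>0 where "g\<^sub>0 \<in> F" "len g\<^sub>0 = Max (len ` F)"
        by auto
      then show thesis
        using that F by simp
    qed
    define x where "x = (\<lambda>i. \<lambda>t\<in>T. test_point (double_word (\<pi> t g\<^sub>0)) i)"
    have "x \<in> ?X"
      unfolding X
    proof (intro allI conjI ballI)
      fix i t assume t: "t \<in> T"
      have "double_word (\<pi> t g\<^sub>0) \<in> lists (gens \<times> UNIV)"
        using g\<^sub>0 F by (intro double_word_lists word(1) t) blast
      then have "double_word (\<pi> t g\<^sub>0) ! i \<in> gens \<times> UNIV" if "i < length (double_word (\<pi> t g\<^sub>0))"
        using that by (meson in_listsD nth_mem)
      then show "fst (x i t) \<in> insert None (Some ` (gens \<times> UNIV))"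
        using t by (auto simp: x_def test_point_def)
    qed (simp add: x_def)
    moreover have "act g x 0 \<in> {s. \<forall>t\<in>T. snd (s t)} \<longleftrightarrow> g = g\<^sub>0" if g: "g \<in> F" for g
    proof -
      have hit: "snd (act g x 0 t) \<longleftrightarrow> \<pi> t g = \<pi> t g\<^sub>0"
        if t: "t \<in> T" and "length (\<pi> t g) \<le> length (\<pi> t g\<^sub>0)" for t
      proof -
        have "distinct_adj (double_word (\<pi> t g\<^sub>0))"
          using g\<^sub>0 F by (intro distinct_adj_double_word word(2) t) blast
        then show ?thesis
          using that foldr_flip_test_point [of "double_word (\<pi> t g\<^sub>0)" 0 "double_word (\<pi> t g)"]
          by (simp add: act_def x_def)
      qed
      show ?thesis
      proof
        assume "act g x 0 \<in> {s. \<forall>t\<in>T. snd (s t)}"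
        then have all: "snd (act g x 0 t)" if "t \<in> T" for t
          using that by blast
        \<comment> \<open>A strictly shorter word would be controlled by \<open>hit\<close> and
          hence equal, which is absurd. So \<open>g\<close> is at least as long on each track, and
          maximality of \<open>len g\<^sub>0\<close> leaves only equal lengths.\<close>
        have le: "length (\<pi> t g\<^sub>0) \<le> length (\<pi> t g)" if "t \<in> T" for t
          using hit [OF that] all [OF that] by (cases "length (\<pi> t g) \<le> length (\<pi> t g\<^sub>0)") simp_all
        have "length (\<pi> t g) \<le> length (\<pi> t g\<^sub>0)" if "t \<in> T" for t
        proof (rule ccontr)
          assume "\<not> ?thesis"
          then have "len g\<^sub>0 < len g"
            unfolding len_def using that le fin by (intro sum_strict_mono_ex1) (auto simp: not_le)
          with max [OF g] show False
            by simp
        qed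
        then have "\<pi> t g = \<pi> t g\<^sub>0" if "t \<in> T" for t
          using hit all that by blast
        then show "g = g\<^sub>0"
          using F g g\<^sub>0 by (blast intro: inj)
      qed (use hit in auto)
    qed
    ultimately show "\<exists>x\<in>?X. \<exists>g\<^sub>0\<in>F. \<forall>g\<in>F. act g x 0 \<in> {s. \<forall>t\<in>T. snd (s t)} \<longleftrightarrow> g = g\<^sub>0"
      using g\<^sub>0 by blast
  qed
  have "2 \<le> card S"
  proof -
    let ?c = "\<lambda>b. \<lambda>t\<in>T. (None, b) :: ('x \<times> bool) option \<times> bool"
    obtain t where "t \<in> T"
      using \<open>T \<noteq> {}\<close> by blast
    then have "?c True t \<noteq> ?c False t"
      by simp
    then have "?c True \<noteq> ?c False"
      by metis
    then have "2 = card {?c True, ?c False}"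
      by simp
    also have "\<dots> \<le> card S"
      using finite_alphabet by (intro card_mono) (auto simp: S_def Q_def)
    finally show ?thesis .
  qed
  then show ?thesis
    using assms(1,2) by (intro wreath_product_in_class)
qed

section \<open>Integers as words in one generator\<close>

definition int_word :: "int \<Rightarrow> (nat \<times> bool) list"
  where "int_word k = replicate (nat \<bar>k\<bar>) (0, 0 \<le> k)"

lemma cons_reduce_int_word:
  "cons_reduce (0, True) (int_word k) = int_word (k + 1)"
  "cons_reduce (0, False) (int_word k) = int_word (k - 1)"
proof -
  \<comment> \<open>The sign of \<open>k\<close> decides whether the new letter cancels or is
    prepended; at 0 the word is empty and the new letter sets the sign.\<close>
  consider "k = 0" | n where "k = int (Suc n)" | n where "k = - int (Suc n)"
    by (metis int_cases3 Suc_pred)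
  then show "cons_reduce (0, True) (int_word k) = int_word (k + 1)"
    by cases (simp_all add: int_word_def inv_letter_def nat_add_distrib)
  consider "k = 0" | n where "k = int (Suc n)" | n where "k = - int (Suc n)"
    by (metis int_cases3 Suc_pred)
  then show "cons_reduce (0, False) (int_word k) = int_word (k - 1)"
    by cases (simp_all add: int_word_def inv_letter_def nat_add_distrib)
qed

lemma int_word_add: "foldr cons_reduce (int_word k) (int_word l) = int_word (k + l)"
proof -
  have "foldr cons_reduce (replicate m (0, b)) (int_word l) = int_word (if b then l + int m else l - int m)"
    for m b
    by (induction m) (auto simp: cons_reduce_int_word algebra_simps)
  then show ?thesis
    by (simp add: int_word_def [of k] add.commute)
qed

lemma int_word_hom: "int_word \<in> hom integer_group (free_group {0})"
proof (rule homI)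
  show "int_word k \<in> carrier (free_group {0})" for k
    by (auto simp: free_group_def int_word_def reduced_word_def inv_letter_def)
qed (simp add: free_group_def int_word_add)

text \<open>The length gives the absolute value, and the letter gives the sign unless the word is
  empty.\<close>

lemma inj_int_word: "inj int_word"
proof
  fix k l assume eq: "int_word k = int_word l"
  then have "length (int_word k) = length (int_word l)"
    by simp
  then have "\<bar>k\<bar> = \<bar>l\<bar>"
    by (simp add: int_word_def)
  moreover from this have "k = 0 \<or> (0 \<le> k \<longleftrightarrow> 0 \<le> l)"
    using eq by (auto simp: int_word_def)
  ultimately show "k = l"
    by auto
qed

theorem corollary1:
  fixes A :: "('a, 'b) monoid_scheme" and n :: nat
  assumes "comm_group A" and "finite (carrier A)"
  shows "wreath_product A (free_group {..<n}) \<in> shift_aut_class_inf \<and>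
         wreath_product A (int_power_group n) \<in> shift_aut_class_inf"
proof
  show "wreath_product A (free_group {..<n}) \<in> shift_aut_class_inf"
    \<comment> \<open>The free group is its own single factor, embedded by the identity.\<close>
    by (rule wreath_product_in_class_if_free_factors
        [where T = "UNIV :: unit set" and \<pi> = "\<lambda>_ w. w" and gens = "{..<n}"])
      (use assms in \<open>auto simp: group_free_group hom_def group.is_monoid monoid.m_closed\<close>)
  \<comment> \<open>Each coordinate is read as a word in its own copy of the free group on one
    generator.\<close>
  define \<pi> where "\<pi> t g = (if t < n then int_word (g t) else [])" for t and g :: "nat \<Rightarrow> int"
  show "wreath_product A (int_power_group n) \<in> shift_aut_class_inf"
    \<comment> \<open>The unused track \<open>n\<close> keeps the set of tracks nonempty when \<open>n = 0\<close>.\<close>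
  proof (rule wreath_product_in_class_if_free_factors [where T = "{..n}" and \<pi> = \<pi> and gens = "{0}"])
    show "group (int_power_group n)"
      by (simp add: int_power_group_def)
    show "\<pi> t \<in> hom (int_power_group n) (free_group {0})" if "t \<in> {..n}" for t
    proof (rule homI)
      show "\<pi> t g \<in> carrier (free_group {0})" for g
        using hom_in_carrier [OF int_word_hom] by (simp add: \<pi>_def) (simp add: free_group_def)
    qed (auto simp: \<pi>_def int_power_group_def free_group_def int_word_add)
    show "g = h" if "g \<in> carrier (int_power_group n)" "h \<in> carrier (int_power_group n)"
      and eq: "\<And>t. t \<in> {..n} \<Longrightarrow> \<pi> t g = \<pi> t h" for g h
    proof -
      have "g t = h t" if "t < n" for t
        using eq [of t] that inj_int_word by (simp add: \<pi>_def inj_eq)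
      then show ?thesis
        using that(1,2) by (intro PiE_ext [of g]) (auto simp: int_power_group_def)
    qed
  qed (use assms in auto)
qed

end
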